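(* Let $n\ge1$, let $\lambda_1\ge\dots\ge\lambda_n>0$ be real numbers, and let $x^0\in\mathbb{R}^n$ with $x^0_i\ge 0$ and $x^0_i\neq 0$ for all $i=1,\dots,n$. Let $f(\mu)=\sum_{i=1}^n\lambda_i\left(\frac{x^0_i}{1+\mu\lambda_i}\right)^2-1$ and $\mathcal I=\,]-\frac1{\lambda_1},+\infty[$. Then the optimal solution of $$\min_{x\in\mathbb{R}^n}\|x-x^0\|_2^2\quad\text{s.t.}\quad\sum_{i=1}^n\lambda_ix_i^2-1=0$$ is given by the unique root $\mu^*$ of $f$ restricted to $\mathcal I$; that is, the optimal solution is $x(\mu^* )$, where $x_i(\mu)=\frac{x^0_i}{1+\mu\lambda_i}$ for $i=1,\dots,n$. *)

theory Defs
  imports "HOL-Analysis.Analysis"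
begin

text \<open>
  The coordinates \<open>1, \<dots>, n\<close> of \<open>\<real>\<^sup>n\<close> are the elements of a finite linearly ordered
  type \<open>'n\<close>; the index \<open>1\<close> is its least element.
\<close>

definition first_index :: "'n::{finite,linorder}" where
  "first_index = Min UNIV"

definition x_mu :: "real ^ 'n \<Rightarrow> real ^ 'n \<Rightarrow> real \<Rightarrow> real ^ 'n" where
  "x_mu lam x0 \<mu> = (\<chi> i. x0 $ i / (1 + \<mu> * lam $ i))"

definition f_mu :: "real ^ 'n \<Rightarrow> real ^ 'n \<Rightarrow> real \<Rightarrow> real" where
  "f_mu lam x0 \<mu> = (\<Sum>i\<in>UNIV. lam $ i * (x0 $ i / (1 + \<mu> * lam $ i))\<^sup>2) - 1"

definition mu_interval :: "real ^ 'n::{finite,linorder} \<Rightarrow> real set" where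
  "mu_interval lam = {- 1 / (lam $ first_index) <..}"

definition optimal_solution :: "real ^ 'n \<Rightarrow> real ^ 'n \<Rightarrow> real ^ 'n \<Rightarrow> bool" where
  "optimal_solution lam x0 x \<longleftrightarrow>
     is_arg_min (\<lambda>y. (norm (y - x0))\<^sup>2) (\<lambda>y. (\<Sum>i\<in>UNIV. lam $ i * (y $ i)\<^sup>2) - 1 = 0) x"

end

theory Submission
  imports Defs
begin

text \<open>
  The number \<open>\<mu>\<close> is a Lagrange multiplier. Adding \<open>\<mu>\<close> times the constraint to the objective
  gives, up to a constant, the separable quadratic \<open>\<Sum>i. (y\<^sub>i - x0\<^sub>i)\<^sup>2 + \<mu> \<lambda>\<^sub>i y\<^sub>i\<^sup>2\<close>, whose
  leading coefficients \<open>1 + \<mu> \<lambda>\<^sub>i\<close> are all positive exactly when \<open>\<mu>\<close> lies in the interval.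
  Completing the square puts
  its minimum at \<open>x(\<mu>)\<close>, and \<open>f(\<mu>) = 0\<close> says that \<open>x(\<mu>)\<close> is feasible. On the feasible set the
  added term is constant, so the squared distance of a feasible \<open>y\<close> exceeds that of \<open>x(\<mu>)\<close> by
  \<open>\<Sum>i. (1 + \<mu> \<lambda>\<^sub>i) (y\<^sub>i - x\<^sub>i(\<mu>))\<^sup>2\<close> (lemma \<open>dist_excess\<close>): although the feasible set is not
  convex, \<open>x(\<mu>)\<close> is the one and only optimal solution (lemma \<open>optimal_iff_x_mu\<close>).

  A root exists by the intermediate value theorem (lemma \<open>ex_root_f_mu\<close>): the first
  summand blows up at the left end of the interval and so takes the value \<open>1\<close> by itself,
  and for large \<open>\<mu>\<close> the sum decays like \<open>\<mu>\<^sup>-\<^sup>2\<close>. Uniqueness of the root comes from uniqueness of the optimal solution: two roots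
  \<open>\<mu>\<close> and \<open>\<nu>\<close> satisfy \<open>x(\<mu>) = x(\<nu>)\<close>, and a nonzero coordinate of \<open>x0\<close> forces \<open>\<mu> = \<nu>\<close>.
\<close>

lemma norm_diff_sq_vec:
  fixes x y :: "real ^ 'n"
  shows "(norm (y - x))\<^sup>2 = (\<Sum>i\<in>UNIV. (y $ i - x $ i)\<^sup>2)"
  unfolding power2_norm_eq_inner inner_vec_def by (simp add: power2_eq_square)

text \<open>
  The first coefficient is the largest, so it gives the binding condition when \<open>\<mu> < 0\<close>.
\<close>

lemma one_plus_mu_lam_pos:
  fixes lam :: "real ^ 'n::{finite,linorder}"
  assumes ordered: "\<And>i j. i \<le> j \<Longrightarrow> lam $ i \<ge> lam $ j"
    and pos: "\<And>i. lam $ i > 0"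
    and mu: "\<mu> \<in> mu_interval lam"
  shows "1 + \<mu> * lam $ i > 0"
proof (cases "\<mu> \<ge> 0")
  case True
  then show ?thesis using pos[of i] by (simp add: add_pos_nonneg)
next
  case False
  have "lam $ i \<le> lam $ first_index"
    by (rule ordered) (simp add: first_index_def)
  with False have "\<mu> * lam $ first_index \<le> \<mu> * lam $ i"
    by (simp add: mult_left_mono_neg)
  moreover have "- 1 < \<mu> * lam $ first_index"
    using mu pos[of first_index] by (simp add: mu_interval_def field_simps)
  ultimately show ?thesis by linarith
qed

text \<open>
  Per coordinate, with \<open>w = 1 + \<mu> \<lambda>\<close> and \<open>x0 = w z\<close>, completing the square gives
  \<open>(y - x0)\<^sup>2 + \<mu> \<lambda> y\<^sup>2 = w (y - z)\<^sup>2 + c\<close> with \<open>c\<close> independent of \<open>y\<close>; subtracting the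
  instance \<open>y = z\<close> removes \<open>c\<close>. The two \<open>\<mu> \<lambda>\<close>-terms cancel after summation because both points satisfy the
  same constraint.
\<close>

lemma dist_excess:
  fixes lam x0 y :: "real ^ 'n::finite"
  assumes nz: "\<And>i. 1 + \<mu> * lam $ i \<noteq> 0"
    and root: "f_mu lam x0 \<mu> = 0"
    and feas: "(\<Sum>i\<in>UNIV. lam $ i * (y $ i)\<^sup>2) - 1 = 0"
  shows "(norm (y - x0))\<^sup>2 = (norm (x_mu lam x0 \<mu> - x0))\<^sup>2
           + (\<Sum>i\<in>UNIV. (1 + \<mu> * lam $ i) * (y $ i - x_mu lam x0 \<mu> $ i)\<^sup>2)"
proof -
  define z where "z = x_mu lam x0 \<mu>"
  have x0: "x0 $ i = (1 + \<mu> * lam $ i) * z $ i" for i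
    using nz[of i] by (simp add: z_def x_mu_def)
  have "(y $ i - x0 $ i)\<^sup>2 = (z $ i - x0 $ i)\<^sup>2 + (1 + \<mu> * lam $ i) * (y $ i - z $ i)\<^sup>2
          + \<mu> * (lam $ i * (z $ i)\<^sup>2) - \<mu> * (lam $ i * (y $ i)\<^sup>2)" for i
    unfolding x0 by algebra
  then have "(norm (y - x0))\<^sup>2 = (norm (z - x0))\<^sup>2
       + (\<Sum>i\<in>UNIV. (1 + \<mu> * lam $ i) * (y $ i - z $ i)\<^sup>2)
       + \<mu> * (\<Sum>i\<in>UNIV. lam $ i * (z $ i)\<^sup>2) - \<mu> * (\<Sum>i\<in>UNIV. lam $ i * (y $ i)\<^sup>2)"
    unfolding norm_diff_sq_vec
    by (simp add: sum.distrib sum_subtractf sum_distrib_left)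
  moreover have "(\<Sum>i\<in>UNIV. lam $ i * (z $ i)\<^sup>2) = 1"
    using root by (simp add: f_mu_def z_def x_mu_def)
  ultimately show ?thesis using feas by (simp add: z_def)
qed

text \<open>
  All weights in the excess are positive, so it is nonnegative and vanishes only at \<open>x(\<mu>)\<close>.
\<close>

lemma optimal_iff_x_mu:
  fixes lam x0 x :: "real ^ 'n::finite"
  assumes pos: "\<And>i. 1 + \<mu> * lam $ i > 0"
    and root: "f_mu lam x0 \<mu> = 0"
  shows "optimal_solution lam x0 x \<longleftrightarrow> x = x_mu lam x0 \<mu>"
proof -
  define z where "z = x_mu lam x0 \<mu>"
  define E where "E y = (\<Sum>i\<in>UNIV. (1 + \<mu> * lam $ i) * (y $ i - z $ i)\<^sup>2)" for y :: "real ^ 'n"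
  have excess: "(norm (y - x0))\<^sup>2 = (norm (z - x0))\<^sup>2 + E y"
    if "(\<Sum>i\<in>UNIV. lam $ i * (y $ i)\<^sup>2) - 1 = 0" for y
    unfolding E_def z_def
    by (rule dist_excess[OF less_imp_neq[OF pos, symmetric] root that])
  have E_nonneg: "E y \<ge> 0" for y
    unfolding E_def using pos by (simp add: sum_nonneg less_imp_le)
  have E_zero: "y = z" if "E y = 0" for y
  proof -
    have "\<forall>i\<in>UNIV. (1 + \<mu> * lam $ i) * (y $ i - z $ i)\<^sup>2 = 0"
      using that pos unfolding E_def
      by (subst (asm) sum_nonneg_eq_0_iff) (auto simp: less_imp_le)
    then have "y $ i = z $ i" for i
      using pos[of i] by (metis UNIV_I eq_iff_diff_eq_0 less_irrefl mult_eq_0_iff power_eq_0_iff)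
    then show ?thesis by (simp add: vec_eq_iff)
  qed
  have z_feas: "(\<Sum>i\<in>UNIV. lam $ i * (z $ i)\<^sup>2) - 1 = 0"
    using root by (simp add: f_mu_def z_def x_mu_def)
  have "optimal_solution lam x0 z"
    unfolding optimal_solution_def is_arg_min_linorder
  proof (intro conjI allI impI)
    fix y :: "real ^ 'n"
    assume "(\<Sum>i\<in>UNIV. lam $ i * (y $ i)\<^sup>2) - 1 = 0"
    then show "(norm (z - x0))\<^sup>2 \<le> (norm (y - x0))\<^sup>2"
      using excess[of y] E_nonneg[of y] by linarith
  qed (rule z_feas)
  moreover have "x = z" if "optimal_solution lam x0 x"
  proof (rule E_zero)
    have feas: "(\<Sum>i\<in>UNIV. lam $ i * (x $ i)\<^sup>2) - 1 = 0"
      and "(norm (x - x0))\<^sup>2 \<le> (norm (z - x0))\<^sup>2"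
      using that z_feas unfolding optimal_solution_def is_arg_min_linorder by blast+
    then show "E x = 0" using excess[OF feas] E_nonneg[of x] by linarith
  qed
  ultimately show ?thesis unfolding z_def by blast
qed

lemma ex_root_f_mu:
  fixes lam x0 :: "real ^ 'n::{finite,linorder}"
  assumes ordered: "\<And>i j. i \<le> j \<Longrightarrow> lam $ i \<ge> lam $ j"
    and pos: "\<And>i. lam $ i > 0"
    and x0_first: "x0 $ first_index > 0"
  shows "\<exists>\<mu> \<in> mu_interval lam. f_mu lam x0 \<mu> = 0"
proof -
  define l where "l = lam $ first_index"
  define e where "e = sqrt l * x0 $ first_index"
  \<comment> \<open>At \<open>a\<close> the first denominator is \<open>e\<close>, which makes the first summand equal to \<open>1\<close>.\<close>
  define a where "a = (e - 1) / l"
  \<comment> \<open>For \<open>\<mu> > 0\<close>, dropping the \<open>1\<close> in the denominators bounds the sum by \<open>C / \<mu>\<^sup>2\<close>.\<close>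
  define C where "C = (\<Sum>i\<in>UNIV. (x0 $ i)\<^sup>2 / lam $ i)"
  define b where "b = max a (max 1 (sqrt C))"
  have l: "l > 0" and e: "e > 0"
    using pos x0_first by (simp_all add: l_def e_def)
  have a_in: "a \<in> mu_interval lam"
    using l e by (simp add: mu_interval_def a_def l_def[symmetric] field_simps)
  have in_interval: "\<mu> \<in> mu_interval lam" if "a \<le> \<mu>" for \<mu>
    using a_in that by (simp add: mu_interval_def)
  have fa: "f_mu lam x0 a \<ge> 0"
  proof -
    have "1 + a * l = e" using l by (simp add: a_def)
    then have "1 = l * (x0 $ first_index / (1 + a * l))\<^sup>2"
      using l x0_first by (simp add: e_def power_divide power_mult_distrib)
    also have "\<dots> \<le> (\<Sum>i\<in>UNIV. lam $ i * (x0 $ i / (1 + a * lam $ i))\<^sup>2)"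
      unfolding l_def by (rule member_le_sum) (use pos in \<open>auto simp: less_imp_le\<close>)
    finally show ?thesis by (simp add: f_mu_def)
  qed
  have fb: "f_mu lam x0 b \<le> 0"
  proof -
    have b: "b \<ge> 1" "b \<ge> sqrt C" by (auto simp: b_def)
    have "lam $ i * (x0 $ i / (1 + b * lam $ i))\<^sup>2 \<le> (x0 $ i)\<^sup>2 / lam $ i / b\<^sup>2" for i
    proof -
      have "(b * lam $ i)\<^sup>2 \<le> (1 + b * lam $ i)\<^sup>2" "0 < (b * lam $ i)\<^sup>2"
        using b pos[of i] by (auto intro!: power_mono)
      then have "(x0 $ i)\<^sup>2 / (1 + b * lam $ i)\<^sup>2 \<le> (x0 $ i)\<^sup>2 / (b * lam $ i)\<^sup>2"
        by (intro frac_le) simp_all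
      then have "lam $ i * ((x0 $ i)\<^sup>2 / (1 + b * lam $ i)\<^sup>2)
          \<le> lam $ i * ((x0 $ i)\<^sup>2 / (b * lam $ i)\<^sup>2)"
        using pos[of i] by (intro mult_left_mono) auto
      also have "\<dots> = (x0 $ i)\<^sup>2 / lam $ i / b\<^sup>2"
        using pos[of i] by (simp add: power2_eq_square)
      finally show ?thesis by (simp add: power_divide)
    qed
    then have "(\<Sum>i\<in>UNIV. lam $ i * (x0 $ i / (1 + b * lam $ i))\<^sup>2) \<le> C / b\<^sup>2"
      unfolding C_def sum_divide_distrib by (rule sum_mono)
    also have "C \<le> b\<^sup>2" using b(2) by (rule sqrt_le_D)
    then have "C / b\<^sup>2 \<le> 1" using b(1) by simp
    finally show ?thesis by (simp add: f_mu_def)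
  qed
  have cont: "continuous_on {a..b} (f_mu lam x0)"
  proof -
    have "1 + \<mu> * lam $ i > 0" if "\<mu> \<in> {a..b}" for \<mu> i
      by (rule one_plus_mu_lam_pos[OF ordered pos in_interval]) (use that in auto)
    then have "1 + \<mu> * lam $ i \<noteq> 0" if "\<mu> \<in> {a..b}" for \<mu> i
      using that by (metis less_irrefl)
    then show ?thesis
      unfolding f_mu_def by (intro continuous_intros) auto
  qed
  have "a \<le> b" by (simp add: b_def)
  from IVT2'[OF fb fa this cont] in_interval show ?thesis by auto
qed

theorem proposition2p6:
  fixes lam x0 :: "real ^ 'n::{finite,linorder}"
  assumes lam_ordered: "\<And>i j. i \<le> j \<Longrightarrow> lam $ i \<ge> lam $ j"
    and lam_pos: "\<And>i. lam $ i > 0"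
    and x0_nonneg: "\<And>i. x0 $ i \<ge> 0"
    and x0_nonzero: "\<And>i. x0 $ i \<noteq> 0"
  shows "(\<exists>!\<mu>. \<mu> \<in> mu_interval lam \<and> f_mu lam x0 \<mu> = 0) \<and>
         (\<forall>\<mu> \<in> mu_interval lam. f_mu lam x0 \<mu> = 0 \<longrightarrow>
            (\<forall>x. optimal_solution lam x0 x \<longleftrightarrow> x = x_mu lam x0 \<mu>))"
proof -
  have denom_pos: "1 + \<mu> * lam $ i > 0" if "\<mu> \<in> mu_interval lam" for \<mu> i
    by (rule one_plus_mu_lam_pos[OF lam_ordered lam_pos that])
  have optimal: "optimal_solution lam x0 x \<longleftrightarrow> x = x_mu lam x0 \<mu>"
    if "\<mu> \<in> mu_interval lam" "f_mu lam x0 \<mu> = 0" for \<mu> x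
    using optimal_iff_x_mu[OF denom_pos[OF that(1)] that(2)] .
  have "x0 $ first_index > 0"
    using x0_nonneg x0_nonzero by (metis order_le_less)
  then have ex: "\<exists>\<mu>. \<mu> \<in> mu_interval lam \<and> f_mu lam x0 \<mu> = 0"
    using ex_root_f_mu[OF lam_ordered lam_pos] by blast
  have "\<mu> = \<nu>"
    if mu: "\<mu> \<in> mu_interval lam" "f_mu lam x0 \<mu> = 0"
      and nu: "\<nu> \<in> mu_interval lam" "f_mu lam x0 \<nu> = 0" for \<mu> \<nu>
  proof -
    have "x_mu lam x0 \<mu> = x_mu lam x0 \<nu>"
      using optimal[OF mu] optimal[OF nu] by blast
    then have "x_mu lam x0 \<mu> $ first_index = x_mu lam x0 \<nu> $ first_index"
      by simp
    then have "1 + \<mu> * lam $ first_index = 1 + \<nu> * lam $ first_index"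
      using denom_pos[OF mu(1), of first_index] denom_pos[OF nu(1), of first_index]
        x0_nonzero[of first_index]
      by (simp add: x_mu_def frac_eq_eq)
    then show ?thesis using lam_pos[of first_index] by simp
  qed
  with ex optimal show ?thesis by blast
qed

end
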